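(* Let $N_a\ge 2$, $r>0$, and let $l_0,l_1>0$ with $l_1^2\ge 4l_0$, so that the polynomial $s^2+l_1s+l_0$ has negative real roots $-\lambda_1,-\lambda_2$. Let the state $x$ (positions and velocities in the plane of all $N_a$ agents) belong to the admissible set $$\mathcal C^*=\Big\{x:\ h_{ij}(x)\ge 0,\ \ h_{ij}(x)\ge -\tfrac{1}{\lambda_1}\dot h_{ij}(x)\ \text{ for all } i,j\in\{1,\dots,N_a\},\ i\ne j\Big\}.$$ Then each of the following quadratic programs is feasible and has a unique solution, for any values of the baseline controls $u_{0i}\in\mathbb R^2$, of the parameters $\rho_i\in\mathbb R$, and of the disturbance estimates $\hat w_{ij}\in\mathbb R^2$: (1) (Centralized QP) minimize $\sum_{i=1}^{N_a}\|u_i-u_{0i}\|^2$ over $u_1,\dots,u_{N_a}\in\mathbb R^2$ subject to $a_{ij}+b_{ij}(u_i-u_j)\ge 0$ for all $i\neq j$ in $\{1,\dots,N_a\}$. (2) (CCS QP for agent $i$, for each fixed $i$) minimize $\sum_{j=1}^{N_a}\|u_{ij}\|^2$ over $u_{i1},\dots,u_{iN_a}\in\mathbb R^2$ subject to $a_{ij}+\rho_i b_{ij}u_{0i}+b_{ij}(u_{ii}-u_{ij})\ge 0$ for all $j\ne i$, and $a_{jk}+b_{jk}(u_{ij}-u_{ik})\ge 0$ for all $j\neq k$ with $j,k\ne i$. (3) (PCCA QP for agent $i$, for each fixed $i$) minimize $\|u_{ii}-u_{0i}\|^2+\sum_{j\ne i}\|u_{ij}\|^2$ over $u_{i1},\dots,u_{iN_a}\in\mathbb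 R^2$ subject to $a_{ij}+b_{ij}(u_{ii}-u_{ij}-\hat w_{ij})\ge 0$ for all $j\neq i$, and $a_{jk}+b_{jk}(u_{ij}+\hat w_{ij}-u_{ik}-\hat w_{ik})\ge 0$ for all $j\ne k$ with $j,k\neq i$.
   Context: Agent $i$ has position $p_i\in\mathbb R^2$ and velocity $v_i\in\mathbb R^2$, with double-integrator dynamics $\dot p_i=v_i$, $\dot v_i=u_i$, where $u_i\in\mathbb R^2$ is its control. For a pair $i\neq j$ put $\xi_{ij}=p_i-p_j\in\mathbb R^2$ and $v_{ij}=v_i-v_j\in\mathbb R^2$. The barrier function is $h_{ij}=\xi_{ij}^T\xi_{ij}-r^2$, where $r>0$ is the required minimum center-to-center distance; its time derivative is $\dot h_{ij}=2\xi_{ij}^Tv_{ij}$. The quantities in the constraints are $$a_{ij}=2v_{ij}^Tv_{ij}+2l_1\xi_{ij}^Tv_{ij}+l_0(\xi_{ij}^T\xi_{ij}-r^2)\in\mathbb R,\qquad b_{ij}=2\xi_{ij}^T\ (\text{a } 1\times 2 \text{ row vector}),$$ so that $a_{ij}+b_{ij}(u_i-u_j)=\ddot h_{ij}+l_1\dot h_{ij}+l_0h_{ij}$. A quadratic program is feasible if some choice of the decision variables satisfies all its constraints; a solution is a minimizer. In (2) and (3), $u_{ij}$ denotes the decision variable of agent $i$'s program representing the control of agent $j$. *)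

theory Defs
  imports "HOL-Analysis.Analysis"
begin

text \<open>
  Agents are the elements of a finite type \<open>'n\<close>, so that \<open>CARD('n)\<close> is the number \<open>N\<^sub>a\<close>
  of agents.  A state is the pair of all positions and all velocities in the plane.
\<close>

type_synonym 'n agent_vectors = "(real^2, 'n) vec"
type_synonym 'n state = "'n agent_vectors \<times> 'n agent_vectors"

definition xi :: "'n::finite state \<Rightarrow> 'n \<Rightarrow> 'n \<Rightarrow> real^2" where
  "xi x i j = fst x $ i - fst x $ j"

definition vel :: "'n::finite state \<Rightarrow> 'n \<Rightarrow> 'n \<Rightarrow> real^2" where
  "vel x i j = snd x $ i - snd x $ j"

definition cbf_h :: "real \<Rightarrow> 'n::finite state \<Rightarrow> 'n \<Rightarrow> 'n \<Rightarrow> real" where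
  "cbf_h r x i j = xi x i j \<bullet> xi x i j - r\<^sup>2"

definition cbf_hdot :: "'n::finite state \<Rightarrow> 'n \<Rightarrow> 'n \<Rightarrow> real" where
  "cbf_hdot x i j = 2 * (xi x i j \<bullet> vel x i j)"

definition cbf_a :: "real \<Rightarrow> real \<Rightarrow> real \<Rightarrow> 'n::finite state \<Rightarrow> 'n \<Rightarrow> 'n \<Rightarrow> real" where
  "cbf_a l0 l1 r x i j =
     2 * (vel x i j \<bullet> vel x i j) + 2 * l1 * (xi x i j \<bullet> vel x i j)
     + l0 * (xi x i j \<bullet> xi x i j - r\<^sup>2)"

text \<open>The row vector \<open>b\<^sub>i\<^sub>j\<close> is a plane vector; its product with a column vector is \<open>\<bullet>\<close>.\<close>

definition cbf_b :: "'n::finite state \<Rightarrow> 'n \<Rightarrow> 'n \<Rightarrow> real^2" where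
  "cbf_b x i j = 2 *\<^sub>R xi x i j"

text \<open>
  Along trajectories of the double integrators, \<open>cbf_hdot\<close> is the time derivative of \<open>cbf_h\<close>, and
  \<open>a\<^sub>i\<^sub>j + b\<^sub>i\<^sub>j (u\<^sub>i - u\<^sub>j)\<close> is the second derivative of \<open>cbf_h\<close> plus \<open>l1 * cbf_hdot + l0 * cbf_h\<close>.
\<close>

lemma h_has_derivative_hdot:
  fixes p v :: "real \<Rightarrow> 'n::finite agent_vectors"
  assumes "\<And>k. ((\<lambda>t. p t $ k) has_vector_derivative v t $ k) (at t)"
  shows "((\<lambda>t. cbf_h r (p t, v t) i j) has_real_derivative cbf_hdot (p t, v t) i j) (at t)"
  unfolding cbf_h_def cbf_hdot_def xi_def vel_def has_real_derivative_iff_has_vector_derivative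
  by (auto intro!: derivative_eq_intros assms
        bounded_bilinear.has_vector_derivative[OF bounded_bilinear_inner]
      simp: inner_commute)

lemma hdot_has_derivative:
  fixes p v u :: "real \<Rightarrow> 'n::finite agent_vectors"
  assumes "\<And>k. ((\<lambda>t. p t $ k) has_vector_derivative v t $ k) (at t)"
    and "\<And>k. ((\<lambda>t. v t $ k) has_vector_derivative u t $ k) (at t)"
  shows "((\<lambda>t. cbf_hdot (p t, v t) i j) has_real_derivative
            cbf_a l0 l1 r (p t, v t) i j + cbf_b (p t, v t) i j \<bullet> (u t $ i - u t $ j)
            - l1 * cbf_hdot (p t, v t) i j - l0 * cbf_h r (p t, v t) i j) (at t)"
proof -
  have "((\<lambda>t. (p t $ i - p t $ j) \<bullet> (v t $ i - v t $ j)) has_vector_derivative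
      ((p t $ i - p t $ j) \<bullet> (u t $ i - u t $ j) + (v t $ i - v t $ j) \<bullet> (v t $ i - v t $ j))) (at t)"
    by (intro bounded_bilinear.has_vector_derivative[OF bounded_bilinear_inner]
          has_vector_derivative_diff assms)
  from DERIV_cmult[OF this[folded has_real_derivative_iff_has_vector_derivative], of 2]
  show ?thesis
    by (simp add: cbf_h_def cbf_hdot_def xi_def vel_def cbf_a_def cbf_b_def algebra_simps)
qed

definition admissible_set :: "real \<Rightarrow> real \<Rightarrow> 'n::finite state set" where
  "admissible_set r lam1 =
     {x. \<forall>i j. i \<noteq> j \<longrightarrow> cbf_h r x i j \<ge> 0 \<and> cbf_h r x i j \<ge> - (1 / lam1) * cbf_hdot x i j}"

definition qp_feasible :: "'u set \<Rightarrow> bool" where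
  "qp_feasible C \<longleftrightarrow> C \<noteq> {}"

definition qp_unique_solution :: "('u \<Rightarrow> real) \<Rightarrow> 'u set \<Rightarrow> bool" where
  "qp_unique_solution J C \<longleftrightarrow> (\<exists>!u. is_arg_min J (\<lambda>u. u \<in> C) u)"

definition central_cost :: "('n \<Rightarrow> real^2) \<Rightarrow> 'n::finite agent_vectors \<Rightarrow> real" where
  "central_cost u0 u = (\<Sum>i\<in>UNIV. (norm (u $ i - u0 i))\<^sup>2)"

definition central_constraints ::
  "real \<Rightarrow> real \<Rightarrow> real \<Rightarrow> 'n::finite state \<Rightarrow> 'n agent_vectors set" where
  "central_constraints l0 l1 r x =
     {u. \<forall>i j. i \<noteq> j \<longrightarrow> cbf_a l0 l1 r x i j + cbf_b x i j \<bullet> (u $ i - u $ j) \<ge> 0}"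

text \<open>In the programs of agent \<open>i\<close>, the decision variable \<open>u\<^sub>i\<^sub>j\<close> is \<open>u $ j\<close>.\<close>

definition ccs_cost :: "'n::finite agent_vectors \<Rightarrow> real" where
  "ccs_cost u = (\<Sum>j\<in>UNIV. (norm (u $ j))\<^sup>2)"

definition ccs_constraints ::
  "real \<Rightarrow> real \<Rightarrow> real \<Rightarrow> 'n::finite state \<Rightarrow> ('n \<Rightarrow> real^2) \<Rightarrow> ('n \<Rightarrow> real) \<Rightarrow> 'n
    \<Rightarrow> 'n agent_vectors set" where
  "ccs_constraints l0 l1 r x u0 rho i =
     {u. (\<forall>j. j \<noteq> i \<longrightarrow>
            cbf_a l0 l1 r x i j + rho i * (cbf_b x i j \<bullet> u0 i) + cbf_b x i j \<bullet> (u $ i - u $ j) \<ge> 0) \<and>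
         (\<forall>j k. j \<noteq> k \<and> j \<noteq> i \<and> k \<noteq> i \<longrightarrow>
            cbf_a l0 l1 r x j k + cbf_b x j k \<bullet> (u $ j - u $ k) \<ge> 0)}"

definition pcca_cost ::
  "('n \<Rightarrow> real^2) \<Rightarrow> 'n \<Rightarrow> 'n::finite agent_vectors \<Rightarrow> real" where
  "pcca_cost u0 i u = (norm (u $ i - u0 i))\<^sup>2 + (\<Sum>j\<in>UNIV - {i}. (norm (u $ j))\<^sup>2)"

definition pcca_constraints ::
  "real \<Rightarrow> real \<Rightarrow> real \<Rightarrow> 'n::finite state \<Rightarrow> ('n \<Rightarrow> 'n \<Rightarrow> real^2) \<Rightarrow> 'n
    \<Rightarrow> 'n agent_vectors set" where
  "pcca_constraints l0 l1 r x w i =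
     {u. (\<forall>j. j \<noteq> i \<longrightarrow>
            cbf_a l0 l1 r x i j + cbf_b x i j \<bullet> (u $ i - u $ j - w i j) \<ge> 0) \<and>
         (\<forall>j k. j \<noteq> k \<and> j \<noteq> i \<and> k \<noteq> i \<longrightarrow>
            cbf_a l0 l1 r x j k + cbf_b x j k \<bullet> (u $ j + w i j - u $ k - w i k) \<ge> 0)}"

end

theory Submission imports Defs begin

text \<open>
  The control \<open>u\<^sub>i = -l\<^sub>1 v\<^sub>i\<close> cancels the cross term of \<open>a\<^sub>i\<^sub>j\<close> and leaves
  \<open>2 |v\<^sub>i\<^sub>j|\<^sup>2 + l\<^sub>0 h\<^sub>i\<^sub>j \<ge> 0\<close>; translating it by the offsets \<open>\<rho>\<^sub>i u\<^sub>0\<^sub>i\<close> or \<open>w\<^sub>i\<^sub>j\<close> gives a feasible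
  point of each decentralized program.  Every cost is the squared distance to a fixed point and every
  constraint is a closed half-space, so the minimizer is the projection onto a nonempty closed
  convex set.
\<close>

text \<open>Minimizing \<open>J\<close> amounts to minimizing the distance to \<open>c\<close>.
  Closedness and nonemptiness of \<open>C\<close> give a nearest point, and convexity makes it the
  only one.\<close>

lemma qp_unique_solution_dist:
  fixes C :: "'a::euclidean_space set"
  assumes "closed C" "convex C" "C \<noteq> {}"
    and J: "\<And>u. J u = (norm (u - c))\<^sup>2"
  shows "qp_unique_solution J C"
  unfolding qp_unique_solution_def
proof (rule ex1I)
  have less_iff: "J y < J u \<longleftrightarrow> dist c y < dist c u" for y u
    by (simp add: J dist_norm norm_minus_commute flip: abs_le_square_iff not_le)
  show "is_arg_min J (\<lambda>u. u \<in> C) (closest_point C c)"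
    using closest_point_exists[OF assms(1,3), of c]
    by (auto simp: is_arg_min_def less_iff not_less)
  show "u = closest_point C c" if "is_arg_min J (\<lambda>u. u \<in> C) u" for u
    using that closest_point_unique[OF assms(2,1)]
    by (auto simp: is_arg_min_def less_iff not_less)
qed

lemma norm_vec_squared:
  fixes u :: "('a::real_normed_vector, 'n::finite) vec"
  shows "(norm u)\<^sup>2 = (\<Sum>i\<in>UNIV. (norm (u $ i))\<^sup>2)"
  by (simp add: norm_vec_def L2_set_def sum_nonneg)

text \<open>Each constraint is affine in \<open>u\<close> and involves only blocks \<open>i\<close>
  and \<open>j\<close>, so it cuts out a half-space whose normal is \<open>b i j\<close> in block
  \<open>i\<close> and \<open>- b i j\<close> in block \<open>j\<close>. Keeping \<open>P\<close>,
  \<open>a\<close> and \<open>b\<close> arbitrary lets one lemma serve all three programs.\<close>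

lemma closed_convex_pairwise_constraints:
  fixes b :: "'n::finite \<Rightarrow> 'n \<Rightarrow> 'a::euclidean_space"
  shows "closed {u :: ('a, 'n) vec. \<forall>i j. P i j \<longrightarrow> 0 \<le> a i j + b i j \<bullet> (u $ i - u $ j)}"
    and "convex {u :: ('a, 'n) vec. \<forall>i j. P i j \<longrightarrow> 0 \<le> a i j + b i j \<bullet> (u $ i - u $ j)}"
proof -
  have eq: "{u :: ('a, 'n) vec. \<forall>i j. P i j \<longrightarrow> 0 \<le> a i j + b i j \<bullet> (u $ i - u $ j)}
      = (\<Inter>(i, j)\<in>{(i, j). P i j}. {u. (axis i (b i j) - axis j (b i j)) \<bullet> u \<ge> - a i j})"
    by (auto simp: inner_diff_left inner_diff_right inner_axis' algebra_simps)
  show "closed {u :: ('a, 'n) vec. \<forall>i j. P i j \<longrightarrow> 0 \<le> a i j + b i j \<bullet> (u $ i - u $ j)}"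
    unfolding eq by (intro closed_INT ballI) (auto simp: closed_halfspace_ge)
  show "convex {u :: ('a, 'n) vec. \<forall>i j. P i j \<longrightarrow> 0 \<le> a i j + b i j \<bullet> (u $ i - u $ j)}"
    unfolding eq by (intro convex_INT) (auto simp: convex_halfspace_ge)
qed

lemma constraint_velocity_damping:
  assumes "0 \<le> l0" "0 \<le> cbf_h r x i j"
  shows "0 \<le> cbf_a l0 l1 r x i j + cbf_b x i j \<bullet> (- l1 *\<^sub>R vel x i j)"
proof -
  have "cbf_a l0 l1 r x i j + cbf_b x i j \<bullet> (- l1 *\<^sub>R vel x i j)
      = 2 * (vel x i j \<bullet> vel x i j) + l0 * cbf_h r x i j"
    by (simp add: cbf_a_def cbf_b_def cbf_h_def)
  then show ?thesis
    using assms by simp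
qed

theorem proposition1:
  fixes r l0 l1 lam1 lam2 :: real
    and x :: "'n::finite state"
    and u0 :: "'n \<Rightarrow> real^2"
    and rho :: "'n \<Rightarrow> real"
    and w :: "'n \<Rightarrow> 'n \<Rightarrow> real^2"
  assumes "CARD('n) \<ge> 2"
    and "r > 0" and "l0 > 0" and "l1 > 0" and "l1\<^sup>2 \<ge> 4 * l0"
    and "\<forall>s. s\<^sup>2 + l1 * s + l0 = (s + lam1) * (s + lam2)"
    and "x \<in> admissible_set r lam1"
  shows "(qp_feasible (central_constraints l0 l1 r x) \<and>
          qp_unique_solution (central_cost u0) (central_constraints l0 l1 r x)) \<and>
         (\<forall>i. qp_feasible (ccs_constraints l0 l1 r x u0 rho i) \<and>
              qp_unique_solution ccs_cost (ccs_constraints l0 l1 r x u0 rho i)) \<and>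
         (\<forall>i. qp_feasible (pcca_constraints l0 l1 r x w i) \<and>
              qp_unique_solution (pcca_cost u0 i) (pcca_constraints l0 l1 r x w i))"
proof (intro conjI allI)
  define U :: "'n agent_vectors" where "U = (\<chi> k. - l1 *\<^sub>R snd x $ k)"
  \<comment> \<open>Differences of \<open>U\<close> are \<open>- l1 *\<^sub>R vel x i j\<close>, the
    relative control of the damping lemma.\<close>
  have U: "0 \<le> cbf_a l0 l1 r x i j + cbf_b x i j \<bullet> (U $ i - U $ j)" if "i \<noteq> j" for i j
    using constraint_velocity_damping[of l0 r x i j l1] assms(3,7) that
    by (simp add: U_def vel_def admissible_set_def algebra_simps)
  have "U \<in> central_constraints l0 l1 r x"
    using U by (simp add: central_constraints_def)
  then show central: "qp_feasible (central_constraints l0 l1 r x)"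
    by (auto simp: qp_feasible_def)
  show "qp_unique_solution (central_cost u0) (central_constraints l0 l1 r x)"
  proof (rule qp_unique_solution_dist)
    show "closed (central_constraints l0 l1 r x)" "convex (central_constraints l0 l1 r x)"
      unfolding central_constraints_def by (rule closed_convex_pairwise_constraints)+
    show "central_constraints l0 l1 r x \<noteq> {}"
      using central by (simp add: qp_feasible_def)
    show "central_cost u0 u = (norm (u - (\<chi> k. u0 k)))\<^sup>2" for u
      by (simp add: central_cost_def norm_vec_squared)
  qed
  fix i :: 'n
  \<comment> \<open>The shift of agent \<open>i\<close>'s own block cancels
    \<open>rho i * (cbf_b x i j \<bullet> u0 i)\<close>; pairs without \<open>i\<close> see
    \<open>U\<close> unchanged.\<close>
  have "(\<chi> k. if k = i then U $ k - rho i *\<^sub>R u0 i else U $ k) \<in> ccs_constraints l0 l1 r x u0 rho i"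
    using U by (auto simp: ccs_constraints_def inner_diff_right)
  then show ccs: "qp_feasible (ccs_constraints l0 l1 r x u0 rho i)"
    by (auto simp: qp_feasible_def)
  \<comment> \<open>The baseline term does not depend on \<open>u\<close>, so it joins the constant;
    each of the two constraint families then has the pairwise form.\<close>
  have ccs_eq: "ccs_constraints l0 l1 r x u0 rho i =
      {u. \<forall>j k. j = i \<and> k \<noteq> i \<longrightarrow>
          0 \<le> (cbf_a l0 l1 r x j k + rho i * (cbf_b x j k \<bullet> u0 i)) + cbf_b x j k \<bullet> (u $ j - u $ k)} \<inter>
      {u. \<forall>j k. j \<noteq> k \<and> j \<noteq> i \<and> k \<noteq> i \<longrightarrow>
          0 \<le> cbf_a l0 l1 r x j k + cbf_b x j k \<bullet> (u $ j - u $ k)}"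
    by (auto simp: ccs_constraints_def)
  show "qp_unique_solution ccs_cost (ccs_constraints l0 l1 r x u0 rho i)"
  proof (rule qp_unique_solution_dist)
    show "closed (ccs_constraints l0 l1 r x u0 rho i)" "convex (ccs_constraints l0 l1 r x u0 rho i)"
      unfolding ccs_eq by (intro closed_Int convex_Int closed_convex_pairwise_constraints)+
    show "ccs_constraints l0 l1 r x u0 rho i \<noteq> {}"
      using ccs by (simp add: qp_feasible_def)
    show "ccs_cost u = (norm (u - 0))\<^sup>2" for u :: "'n agent_vectors"
      by (simp add: ccs_cost_def norm_vec_squared)
  qed
  \<comment> \<open>Adding the estimate \<open>w i k\<close> back to block \<open>k\<close> restores
    \<open>U $ k\<close>, so every constraint reduces to the one for \<open>U\<close>.\<close>
  have "(\<chi> k. if k = i then U $ k else U $ k - w i k) \<in> pcca_constraints l0 l1 r x w i"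
    using U by (auto simp: pcca_constraints_def)
  then show pcca: "qp_feasible (pcca_constraints l0 l1 r x w i)"
    by (auto simp: qp_feasible_def)
  \<comment> \<open>Here the estimates are absorbed into the constants.\<close>
  have pcca_eq: "pcca_constraints l0 l1 r x w i =
      {u. \<forall>j k. j = i \<and> k \<noteq> i \<longrightarrow>
          0 \<le> (cbf_a l0 l1 r x j k - cbf_b x j k \<bullet> w i k) + cbf_b x j k \<bullet> (u $ j - u $ k)} \<inter>
      {u. \<forall>j k. j \<noteq> k \<and> j \<noteq> i \<and> k \<noteq> i \<longrightarrow>
          0 \<le> (cbf_a l0 l1 r x j k + cbf_b x j k \<bullet> (w i j - w i k)) + cbf_b x j k \<bullet> (u $ j - u $ k)}"
    by (auto simp: pcca_constraints_def inner_diff_right inner_add_right algebra_simps)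
  show "qp_unique_solution (pcca_cost u0 i) (pcca_constraints l0 l1 r x w i)"
  proof (rule qp_unique_solution_dist)
    show "closed (pcca_constraints l0 l1 r x w i)" "convex (pcca_constraints l0 l1 r x w i)"
      unfolding pcca_eq by (intro closed_Int convex_Int closed_convex_pairwise_constraints)+
    show "pcca_constraints l0 l1 r x w i \<noteq> {}"
      using pcca by (simp add: qp_feasible_def)
    \<comment> \<open>The centre is \<open>u0 i\<close> in block \<open>i\<close> and zero in all
      others; splitting off the summand at \<open>i\<close> matches the two sides.\<close>
    show "pcca_cost u0 i u = (norm (u - axis i (u0 i)))\<^sup>2" for u
      by (simp add: pcca_cost_def norm_vec_squared sum.remove[of UNIV i] axis_def)
  qed
qed

end
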